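(* Let $\Phi$ be an epimorphism of a finite thick projective plane $\mathcal{P}$ onto a thin projective plane $\Delta$ of order $(1,1)$ (an ordinary triangle). Then exactly two classes of epimorphisms $\Phi$ occur, up to a suitable permutation of the points of $\Delta$; that is, after suitably naming the points of $\Delta$, $\Phi$ is as in (a) or (b) below, and both classes occur. (a) The points of $\Delta$ are $\overline{a},\overline{b},\overline{c}$ (pairwise collinear); put $\widetilde{A}=\Phi^{-1}(\overline{a})$, $\widetilde{B}=\Phi^{-1}(\overline{b})$, $\widetilde{C}=\Phi^{-1}(\overline{c})$. There is a line $L$ of $\mathcal{P}$ such that $(\widetilde{A},\widetilde{B})$, with $\widetilde{A}\neq\emptyset\neq\widetilde{B}$, is a partition of the set of all points incident with $L$, and $\widetilde{C}$ consists of the points not incident with $L$. Furthermore, $\Phi^{-1}(\overline{a}\overline{b})=\{L\}$, $\Phi^{-1}(\overline{b}\overline{c})$ is the set of all lines distinct from $L$ but incident with a point of $\widetilde{B}$, and $\Phi^{-1}(\overline{a}\overline{c})$ is the set of all lines distinct from $L$ but incident with a point of $\widetilde{A}$. (b) The dual of (a), i.e. $\Phi$, regarded as an epimorphism from the point-line dual of $\mathcal{P}$ onto the point-line dual of $\Delta$, is as in (a).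
   Context: A thick projective plane is a generalized $3$-gon, i.e. an axiomatic projective plane in which every line has at least three points and every point is on at least three lines. The thin projective plane $\Delta$ of order $(1,1)$ is the ordinary triangle: three points, three lines, every line incident with exactly two points and every point with exactly two lines. A morphism between point-line geometries maps points to points, lines to lines, and preserves incidence. An epimorphism is a morphism that is surjective on points and surjective on lines (surjectivity on incident point-line pairs is not required). $\overline{x}\overline{y}$ denotes the line joining the distinct collinear points $\overline{x},\overline{y}$. The point-line dual of a geometry is obtained by interchanging the roles of points and lines. *)

theory Defs
  imports Main
begin

record ('p, 'l) geometry =
  points :: "'p set"
  lines :: "'l set"
  incidence :: "('p \<times> 'l) set"

definition dual :: "('p, 'l) geometry \<Rightarrow> ('l, 'p) geometry" where
  "dual G = \<lparr>points = lines G, lines = points G, incidence = (incidence G)\<inverse>\<rparr>"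

definition points_on :: "('p, 'l) geometry \<Rightarrow> 'l \<Rightarrow> 'p set" where
  "points_on G l = {x \<in> points G. (x, l) \<in> incidence G}"

definition lines_through :: "('p, 'l) geometry \<Rightarrow> 'p \<Rightarrow> 'l set" where
  "lines_through G x = {l \<in> lines G. (x, l) \<in> incidence G}"

text \<open>The last condition (three points not on a common line) is the non-degeneracy axiom.
  It still admits the ordinary triangle, so that both thick and thin planes are covered.\<close>

definition projective_plane :: "('p, 'l) geometry \<Rightarrow> bool" where
  "projective_plane G \<longleftrightarrow>
     incidence G \<subseteq> points G \<times> lines G \<and>
     (\<forall>x\<in>points G. \<forall>y\<in>points G. x \<noteq> y \<longrightarrow>
        (\<exists>!l. l \<in> lines G \<and> (x, l) \<in> incidence G \<and> (y, l) \<in> incidence G)) \<and>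
     (\<forall>l\<in>lines G. \<forall>m\<in>lines G. l \<noteq> m \<longrightarrow>
        (\<exists>!x. x \<in> points G \<and> (x, l) \<in> incidence G \<and> (x, m) \<in> incidence G)) \<and>
     (\<exists>x\<in>points G. \<exists>y\<in>points G. \<exists>z\<in>points G.
        \<not> (\<exists>l\<in>lines G. {x, y, z} \<subseteq> points_on G l))"

text \<open>``At least three'' is expressed by a three-element subset because \<open>card\<close> is \<open>0\<close> on
  infinite sets.\<close>

definition thick_projective_plane :: "('p, 'l) geometry \<Rightarrow> bool" where
  "thick_projective_plane G \<longleftrightarrow>
     projective_plane G \<and>
     (\<forall>l\<in>lines G. \<exists>T\<subseteq>points_on G l. card T = 3) \<and>
     (\<forall>x\<in>points G. \<exists>T\<subseteq>lines_through G x. card T = 3)"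

text \<open>Order \<open>(1,1)\<close>: two points on every line, two lines through every point.\<close>

definition thin_projective_plane :: "('p, 'l) geometry \<Rightarrow> bool" where
  "thin_projective_plane G \<longleftrightarrow>
     projective_plane G \<and>
     (\<forall>l\<in>lines G. card (points_on G l) = 2) \<and>
     (\<forall>x\<in>points G. card (lines_through G x) = 2)"

definition finite_geometry :: "('p, 'l) geometry \<Rightarrow> bool" where
  "finite_geometry G \<longleftrightarrow> finite (points G) \<and> finite (lines G)"

definition join :: "('p, 'l) geometry \<Rightarrow> 'p \<Rightarrow> 'p \<Rightarrow> 'l" where
  "join G x y = (THE l. l \<in> lines G \<and> (x, l) \<in> incidence G \<and> (y, l) \<in> incidence G)"

text \<open>A morphism is a pair of maps, \<open>f\<close> on points and \<open>g\<close> on lines; their values outside the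
  carriers are irrelevant.\<close>

definition morphism ::
  "('p, 'l) geometry \<Rightarrow> ('q, 'm) geometry \<Rightarrow> ('p \<Rightarrow> 'q) \<Rightarrow> ('l \<Rightarrow> 'm) \<Rightarrow> bool" where
  "morphism G H f g \<longleftrightarrow>
     f ` points G \<subseteq> points H \<and> g ` lines G \<subseteq> lines H \<and>
     (\<forall>x\<in>points G. \<forall>l\<in>lines G. (x, l) \<in> incidence G \<longrightarrow> (f x, g l) \<in> incidence H)"

definition epimorphism ::
  "('p, 'l) geometry \<Rightarrow> ('q, 'm) geometry \<Rightarrow> ('p \<Rightarrow> 'q) \<Rightarrow> ('l \<Rightarrow> 'm) \<Rightarrow> bool" where
  "epimorphism G H f g \<longleftrightarrow>
     morphism G H f g \<and> f ` points G = points H \<and> g ` lines G = lines H"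

definition point_fibre :: "('p, 'l) geometry \<Rightarrow> ('p \<Rightarrow> 'q) \<Rightarrow> 'q \<Rightarrow> 'p set" where
  "point_fibre G f a = {x \<in> points G. f x = a}"

definition line_fibre :: "('p, 'l) geometry \<Rightarrow> ('l \<Rightarrow> 'm) \<Rightarrow> 'm \<Rightarrow> 'l set" where
  "line_fibre G g m = {l \<in> lines G. g l = m}"

text \<open>The existential choice of \<open>a\<close>, \<open>b\<close>, \<open>c\<close> is the naming of the points of the
  triangle \<open>D\<close>.\<close>

definition class_a ::
  "('p, 'l) geometry \<Rightarrow> ('q, 'm) geometry \<Rightarrow> ('p \<Rightarrow> 'q) \<Rightarrow> ('l \<Rightarrow> 'm) \<Rightarrow> bool" where
  "class_a P D f g \<longleftrightarrow>
     (\<exists>a b c. points D = {a, b, c} \<and> a \<noteq> b \<and> b \<noteq> c \<and> a \<noteq> c \<and>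
       (let A = point_fibre P f a; B = point_fibre P f b; C = point_fibre P f c in
        \<exists>L\<in>lines P.
          A \<noteq> {} \<and> B \<noteq> {} \<and> A \<inter> B = {} \<and> A \<union> B = points_on P L \<and>
          C = points P - points_on P L \<and>
          line_fibre P g (join D a b) = {L} \<and>
          line_fibre P g (join D b c) =
            {M \<in> lines P. M \<noteq> L \<and> (\<exists>x\<in>B. (x, M) \<in> incidence P)} \<and>
          line_fibre P g (join D a c) =
            {M \<in> lines P. M \<noteq> L \<and> (\<exists>x\<in>A. (x, M) \<in> incidence P)}))"

definition class_b ::
  "('p, 'l) geometry \<Rightarrow> ('q, 'm) geometry \<Rightarrow> ('p \<Rightarrow> 'q) \<Rightarrow> ('l \<Rightarrow> 'm) \<Rightarrow> bool" where
  "class_b P D f g \<longleftrightarrow> class_a (dual P) (dual D) g f"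

end

theory Submission
  imports Defs
begin

text \<open>Write \<open>A\<close>, \<open>B\<close>, \<open>C\<close> for the point fibres of an epimorphism, let \<open>p\<close>, \<open>q\<close>, \<open>r\<close> be
  the sides of the triangle opposite \<open>a\<close>, \<open>b\<close>, \<open>c\<close>, and let \<open>N\<close> be the number of points on a
  line. Projecting a line over \<open>r\<close> from a point of \<open>C\<close> shows that the number \<open>k\<close> of points of \<open>A\<close> on
  any line over \<open>r\<close> equals the number of lines over \<open>q\<close> through any point of \<open>C\<close>. Rotating the
  triangle gives three such numbers \<open>k, k', k''\<close> between \<open>1\<close> and \<open>n = N - 1\<close>. Counting the fibres,
  the plane has \<open>k (N - k'') + k' (N - k) + k'' (N - k') = N (N - 1) + 1\<close> points, which is
  equivalent, after multiplication by \<open>n - 1 > 0\<close>, to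
  \<open>(n - k) (n - k') (n - k'') + (k - 1) (k' - 1) (k'' - 1) = 0\<close>. So one of the three numbers is \<open>n\<close> and another one is \<open>1\<close>; the six possibilities are the three rotations of
  (a) and the three rotations of (b).\<close>

section \<open>Duality\<close>

lemma dual_simps [simp]:
  "points (dual G) = lines G" "lines (dual G) = points G"
  "(l, x) \<in> incidence (dual G) \<longleftrightarrow> (x, l) \<in> incidence G"
  "points_on (dual G) x = lines_through G x" "lines_through (dual G) l = points_on G l"
  by (auto simp: dual_def points_on_def lines_through_def)

lemma epimorphism_dual:
  "epimorphism (dual P) (dual D) g f \<longleftrightarrow> epimorphism P D f g"
  by (auto simp: epimorphism_def morphism_def)

section \<open>Projective planes\<close>

text \<open>The uniqueness clauses for joins and for meets merge into the self-dual form
  \<open>x = y \<or> l = m\<close>, which serves both purposes without any membership side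
  conditions.\<close>

lemma projective_planeD:
  assumes "projective_plane P"
  shows projective_plane_incidence: "\<And>x l. (x, l) \<in> incidence P \<Longrightarrow> x \<in> points P \<and> l \<in> lines P"
    and projective_plane_line: "\<And>x y. x \<in> points P \<Longrightarrow> y \<in> points P \<Longrightarrow> x \<noteq> y \<Longrightarrow>
      \<exists>l\<in>lines P. (x, l) \<in> incidence P \<and> (y, l) \<in> incidence P"
    and projective_plane_meet: "\<And>l m. l \<in> lines P \<Longrightarrow> m \<in> lines P \<Longrightarrow> l \<noteq> m \<Longrightarrow>
      \<exists>x\<in>points P. (x, l) \<in> incidence P \<and> (x, m) \<in> incidence P"
    and projective_plane_unique: "\<And>x y l m. (x, l) \<in> incidence P \<Longrightarrow> (y, l) \<in> incidence P \<Longrightarrow>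
      (x, m) \<in> incidence P \<Longrightarrow> (y, m) \<in> incidence P \<Longrightarrow> x = y \<or> l = m"
proof -
  note P = assms[unfolded projective_plane_def]
  note ex1l = P[THEN conjunct2, THEN conjunct1, rule_format]
  note ex1p = P[THEN conjunct2, THEN conjunct2, THEN conjunct1, rule_format]
  show inc: "x \<in> points P \<and> l \<in> lines P" if "(x, l) \<in> incidence P" for x l
    using P[THEN conjunct1] that by blast
  show "\<exists>l\<in>lines P. (x, l) \<in> incidence P \<and> (y, l) \<in> incidence P"
    if "x \<in> points P" "y \<in> points P" "x \<noteq> y" for x y
    using ex1_implies_ex[OF ex1l[OF that]] by blast
  show "\<exists>x\<in>points P. (x, l) \<in> incidence P \<and> (x, m) \<in> incidence P"
    if "l \<in> lines P" "m \<in> lines P" "l \<noteq> m" for l m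
    using ex1_implies_ex[OF ex1p[OF that]] by blast
  show "x = y \<or> l = m" if "(x, l) \<in> incidence P" "(y, l) \<in> incidence P"
    "(x, m) \<in> incidence P" "(y, m) \<in> incidence P" for x y l m
  proof (cases "x = y")
    case False
    note eq = the1_equality[OF ex1l[OF inc[OF that(1), THEN conjunct1]
          inc[OF that(2), THEN conjunct1] False]]
    have "l = m" using eq[of l] eq[of m] that inc[OF that(1)] inc[OF that(3)] by simp
    then show ?thesis ..
  qed simp
qed

lemma projective_plane_ex_point: "projective_plane P \<Longrightarrow> \<exists>x. x \<in> points P"
  unfolding projective_plane_def by auto

lemma join_eqI:
  assumes "projective_plane P" "(x, l) \<in> incidence P" "(y, l) \<in> incidence P" "x \<noteq> y"
  shows "join P x y = l"
  unfolding join_def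
  by (rule the_equality)
    (use assms projective_plane_unique[OF assms(1)] projective_plane_incidence[OF assms(1)] in blast)+

section \<open>Thick planes: third points, third lines and avoidance\<close>

lemma ex_third:
  assumes "card T = 3"
  shows "\<exists>z\<in>T. z \<noteq> x \<and> z \<noteq> y"
proof -
  have "finite T" using assms by (auto intro: card_ge_0_finite)
  have "\<not> T \<subseteq> {x, y}"
  proof
    assume "T \<subseteq> {x, y}"
    from card_mono[OF _ this] have "card T \<le> card {x, y}" by simp
    also have "\<dots> \<le> 2" by (simp add: card_insert_if)
    finally show False using assms by simp
  qed
  then show ?thesis by blast
qed

lemma thick_third_point:
  assumes "thick_projective_plane P" "l \<in> lines P"
  shows "\<exists>z\<in>points P. (z, l) \<in> incidence P \<and> z \<noteq> x \<and> z \<noteq> y"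
proof -
  obtain T where "T \<subseteq> points_on P l" "card T = 3"
    using assms unfolding thick_projective_plane_def by blast
  then show ?thesis using ex_third[of T x y] by (auto simp: points_on_def)
qed

lemma thick_third_line:
  assumes "thick_projective_plane P" "x \<in> points P"
  shows "\<exists>l\<in>lines P. (x, l) \<in> incidence P \<and> l \<noteq> k \<and> l \<noteq> m"
proof -
  obtain T where "T \<subseteq> lines_through P x" "card T = 3"
    using assms unfolding thick_projective_plane_def by blast
  then show ?thesis using ex_third[of T k m] by (auto simp: lines_through_def)
qed

lemma thick_projective_plane_imp: "thick_projective_plane P \<Longrightarrow> projective_plane P"
  by (simp add: thick_projective_plane_def)

text \<open>A line \<open>k\<close> through \<open>x\<close> carries another point \<open>u\<close>.
  A second line through \<open>u\<close> shares only \<open>u\<close> with \<open>k\<close>, hence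
  misses \<open>x\<close>.\<close>

lemma thick_line_avoiding:
  assumes "thick_projective_plane P" "x \<in> points P"
  shows "\<exists>l\<in>lines P. (x, l) \<notin> incidence P"
proof -
  note un = projective_plane_unique[OF thick_projective_plane_imp[OF assms(1)]]
  obtain k where k: "k \<in> lines P" "(x, k) \<in> incidence P"
    using thick_third_line[OF assms] by blast
  obtain u where u: "u \<in> points P" "(u, k) \<in> incidence P" "u \<noteq> x"
    using thick_third_point[OF assms(1) k(1)] by blast
  obtain l where "l \<in> lines P" "(u, l) \<in> incidence P" "l \<noteq> k"
    using thick_third_line[OF assms(1) u(1)] by blast
  then show ?thesis using un k u by blast
qed

text \<open>For distinct lines, join a point of \<open>l\<close> to a point of \<open>m\<close>,
  both away from the intersection; a third point of the join is on neither line. If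
  \<open>l = m\<close>, any other line can stand in for \<open>m\<close>. The point found serves as
  a common centre of projection.\<close>

lemma thick_point_avoiding:
  assumes "thick_projective_plane P" "l \<in> lines P" "m \<in> lines P"
  shows "\<exists>x\<in>points P. (x, l) \<notin> incidence P \<and> (x, m) \<notin> incidence P"
proof -
  note pp = thick_projective_plane_imp[OF assms(1)]
  note un = projective_plane_unique[OF pp]
  have main: "\<exists>x\<in>points P. (x, l) \<notin> incidence P \<and> (x, m) \<notin> incidence P"
    if lm: "l \<in> lines P" "m \<in> lines P" "l \<noteq> m" for l m
  proof -
    obtain w where w: "w \<in> points P" "(w, l) \<in> incidence P" "(w, m) \<in> incidence P"
      using projective_plane_meet[OF pp lm] by blast
    obtain u where u: "u \<in> points P" "(u, l) \<in> incidence P" "u \<noteq> w"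
      using thick_third_point[OF assms(1) lm(1)] by blast
    obtain v where v: "v \<in> points P" "(v, m) \<in> incidence P" "v \<noteq> w"
      using thick_third_point[OF assms(1) lm(2)] by blast
    have "u \<noteq> v" using u v w lm un by blast
    obtain k where k: "k \<in> lines P" "(u, k) \<in> incidence P" "(v, k) \<in> incidence P"
      using projective_plane_line[OF pp u(1) v(1) \<open>u \<noteq> v\<close>] by blast
    obtain z where z: "z \<in> points P" "(z, k) \<in> incidence P" "z \<noteq> u" "z \<noteq> v"
      using thick_third_point[OF assms(1) k(1)] by blast
    have "k \<noteq> l" "k \<noteq> m" using un u v w lm k by blast+
    then show ?thesis using un u v k z by blast
  qed
  show ?thesis
  proof (cases "l = m")
    case True
    obtain x where x: "x \<in> points P" "(x, l) \<in> incidence P"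
      using thick_third_point[OF assms(1,2)] by blast
    obtain m' where "m' \<in> lines P" "m' \<noteq> l"
      using thick_third_line[OF assms(1) x(1)] by blast
    then show ?thesis using main[of l m'] assms True by blast
  qed (use main assms in blast)
qed

text \<open>Joins and meets trade places, and so do the two thickness conditions. Only
  non-degeneracy needs an argument: two lines through \<open>x\<close> and a third one avoiding
  \<open>x\<close> have no common point.\<close>

lemma thick_projective_plane_dual:
  assumes "thick_projective_plane P"
  shows "thick_projective_plane (dual P)"
proof -
  have pp: "projective_plane P" using assms by (rule thick_projective_plane_imp)
  have "\<exists>x\<in>lines P. \<exists>y\<in>lines P. \<exists>z\<in>lines P. \<not> (\<exists>l\<in>points P. {x, y, z} \<subseteq> lines_through P l)"
  proof -
    obtain x where x: "x \<in> points P"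
      using projective_plane_ex_point[OF pp] by blast
    obtain k where k: "k \<in> lines P" "(x, k) \<in> incidence P"
      using thick_third_line[OF assms x] by blast
    obtain l where l: "l \<in> lines P" "(x, l) \<in> incidence P" "l \<noteq> k"
      using thick_third_line[OF assms x] by blast
    obtain m where m: "m \<in> lines P" "(x, m) \<notin> incidence P"
      using thick_line_avoiding[OF assms x] by blast
    have "\<not> (\<exists>z\<in>points P. {k, l, m} \<subseteq> lines_through P z)"
    proof
      assume "\<exists>z\<in>points P. {k, l, m} \<subseteq> lines_through P z"
      then obtain z where z: "(z, k) \<in> incidence P" "(z, l) \<in> incidence P" "(z, m) \<in> incidence P"
        by (auto simp: lines_through_def)
      then have "z = x"
        using projective_plane_unique[OF pp z(1) k(2) z(2) l(2)] l(3) by simp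
      then show False using z(3) m(2) by simp
    qed
    then show ?thesis using k(1) l(1) m(1) by (intro bexI)
  qed
  moreover have "incidence (dual P) \<subseteq> lines P \<times> points P"
    using pp by (auto simp: projective_plane_def)
  ultimately have "projective_plane (dual P)"
    using pp[unfolded projective_plane_def, THEN conjunct2, THEN conjunct1]
      pp[unfolded projective_plane_def, THEN conjunct2, THEN conjunct2, THEN conjunct1]
    unfolding projective_plane_def dual_simps by (intro conjI)
  then show ?thesis
    using assms by (simp add: thick_projective_plane_def)
qed

section \<open>Perspectivities, the order, and counting along a pencil\<close>

text \<open>Since \<open>x\<close> is off \<open>L\<close>, a line through \<open>x\<close> meets
  \<open>L\<close> in exactly one point, and that point recovers the line as its join with
  \<open>x\<close>.\<close>

lemma bij_betw_perspective:
  assumes "projective_plane P" "x \<in> points P" "L \<in> lines P" "(x, L) \<notin> incidence P"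
  shows "bij_betw (join P x) (points_on P L) (lines_through P x)"
proof (rule bij_betw_imageI)
  note un = projective_plane_unique[OF assms(1)]
  have j: "(x, join P x y) \<in> incidence P \<and> (y, join P x y) \<in> incidence P
      \<and> join P x y \<in> lines P" if "y \<in> points_on P L" for y
  proof -
    have "y \<in> points P" "x \<noteq> y" using that assms by (auto simp: points_on_def)
    then obtain l where "l \<in> lines P" "(x, l) \<in> incidence P" "(y, l) \<in> incidence P"
      using projective_plane_line[OF assms(1,2)] by blast
    then show ?thesis using join_eqI[OF assms(1)] \<open>x \<noteq> y\<close> by metis
  qed
  show "inj_on (join P x) (points_on P L)"
  proof (rule inj_onI)
    fix y z assume yz: "y \<in> points_on P L" "z \<in> points_on P L" and "join P x y = join P x z"
    then have "y = z \<or> L = join P x y"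
      using un[of y L z "join P x y"] j[OF yz(1)] j[OF yz(2)] by (simp add: points_on_def)
    then show "y = z" using j[OF yz(1)] assms(4) by auto
  qed
  show "join P x ` points_on P L = lines_through P x"
  proof (intro equalityI subsetI)
    fix l assume "l \<in> lines_through P x"
    then have l: "l \<in> lines P" "(x, l) \<in> incidence P" by (auto simp: lines_through_def)
    then obtain y where y: "y \<in> points P" "(y, l) \<in> incidence P" "(y, L) \<in> incidence P"
      using projective_plane_meet[OF assms(1) _ assms(3)] assms(4) by blast
    then have "join P x y = l" using join_eqI[OF assms(1) l(2)] assms(4) by blast
    with y show "l \<in> join P x ` points_on P L" by (auto simp: points_on_def)
  qed (use j in \<open>auto simp: lines_through_def\<close>)
qed

lemma card_points_on_eq_card_lines_through:
  assumes "projective_plane P" "x \<in> points P" "L \<in> lines P" "(x, L) \<notin> incidence P"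
  shows "card (points_on P L) = card (lines_through P x)"
  using bij_betw_same_card[OF bij_betw_perspective[OF assms]] .

lemma finite_points_on: "finite_geometry P \<Longrightarrow> finite (points_on P l)"
  by (simp add: finite_geometry_def points_on_def)

lemma finite_lines_through: "finite_geometry P \<Longrightarrow> finite (lines_through P x)"
  by (simp add: finite_geometry_def lines_through_def)

text \<open>Two lines are compared by projecting both from a point off them, and a pencil is
  compared with a line avoiding its centre. The common value \<open>N\<close> is one more than the
  order of the plane.\<close>

lemma thick_finite_order:
  assumes "thick_projective_plane P" "finite_geometry P"
  obtains N where "3 \<le> N" "\<And>l. l \<in> lines P \<Longrightarrow> card (points_on P l) = N"
    "\<And>x. x \<in> points P \<Longrightarrow> card (lines_through P x) = N"
proof -
  have pp: "projective_plane P" using assms(1) by (rule thick_projective_plane_imp)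
  obtain x0 where x0: "x0 \<in> points P" using projective_plane_ex_point[OF pp] by blast
  obtain l0 where l0: "l0 \<in> lines P" using thick_third_line[OF assms(1) x0] by blast
  have lin: "card (points_on P l) = card (points_on P l0)" if l: "l \<in> lines P" for l
  proof -
    obtain x where "x \<in> points P" "(x, l) \<notin> incidence P" "(x, l0) \<notin> incidence P"
      using thick_point_avoiding[OF assms(1) l l0] by blast
    then show ?thesis
      using card_points_on_eq_card_lines_through[OF pp _ l, of x]
        card_points_on_eq_card_lines_through[OF pp _ l0, of x] by simp
  qed
  have thr: "card (lines_through P x) = card (points_on P l0)" if x: "x \<in> points P" for x
  proof -
    obtain l where "l \<in> lines P" "(x, l) \<notin> incidence P"
      using thick_line_avoiding[OF assms(1) x] by blast
    then show ?thesis using card_points_on_eq_card_lines_through[OF pp x, of l] lin by simp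
  qed
  have "3 \<le> card (points_on P l0)"
  proof -
    obtain T where "T \<subseteq> points_on P l0" "card T = 3"
      using assms(1) l0 unfolding thick_projective_plane_def by blast
    then show ?thesis using card_mono[OF finite_points_on[OF assms(2)], of T l0] by simp
  qed
  then show thesis using that[of "card (points_on P l0)"] lin thr by simp
qed

text \<open>The lines through \<open>x\<close>, with \<open>x\<close> removed, partition the
  remaining points, so a set avoiding \<open>x\<close> can be counted line by line.\<close>

lemma card_eq_sum_lines_through:
  assumes "projective_plane P" "finite_geometry P" "x \<in> points P" "S \<subseteq> points P" "x \<notin> S"
  shows "card S = (\<Sum>l\<in>lines_through P x. card (points_on P l \<inter> S))"
proof -
  have "S = (\<Union>l\<in>lines_through P x. points_on P l \<inter> S)"
    using projective_plane_line[OF assms(1,3)] assms(4,5)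
    by (fastforce simp: lines_through_def points_on_def)
  then have "card S = card (\<Union>l\<in>lines_through P x. points_on P l \<inter> S)" by simp
  also have "\<dots> = (\<Sum>l\<in>lines_through P x. card (points_on P l \<inter> S))"
  proof (rule card_UN_disjoint)
    show "\<forall>l\<in>lines_through P x. \<forall>m\<in>lines_through P x. l \<noteq> m \<longrightarrow>
        points_on P l \<inter> S \<inter> (points_on P m \<inter> S) = {}"
      using projective_plane_unique[OF assms(1)] assms(5)
      unfolding lines_through_def points_on_def by blast
  qed (use finite_lines_through[OF assms(2)] finite_points_on[OF assms(2)] in auto)
  finally show ?thesis .
qed

lemma card_points:
  assumes "projective_plane P" "finite_geometry P" "x \<in> points P"
    "\<And>l. l \<in> lines P \<Longrightarrow> card (points_on P l) = N" "card (lines_through P x) = N"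
  shows "card (points P) = N * (N - 1) + 1"
proof -
  have "card (points P - {x}) = (\<Sum>l\<in>lines_through P x. card (points_on P l \<inter> (points P - {x})))"
    by (rule card_eq_sum_lines_through[OF assms(1-3)]) auto
  also have "\<dots> = (\<Sum>l\<in>lines_through P x. N - 1)"
  proof (rule sum.cong[OF refl])
    fix l assume l: "l \<in> lines_through P x"
    then have "points_on P l \<inter> (points P - {x}) = points_on P l - {x}" "x \<in> points_on P l"
      using assms(3) by (auto simp: lines_through_def points_on_def)
    then show "card (points_on P l \<inter> (points P - {x})) = N - 1"
      using assms(4) l by (simp add: lines_through_def)
  qed
  also have "\<dots> = N * (N - 1)" using assms(5) by simp
  finally show ?thesis
    using assms(2,3) card_Suc_Diff1[of "points P" x] by (simp add: finite_geometry_def)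
qed

section \<open>The triangle\<close>

text \<open>Each side bears the letter matching its opposite vertex, so a vertex misses exactly one
  side. With this labelling rotations and swaps act alike on both triples, and duality exchanges
  them.\<close>

definition triangle ::
  "('q, 'm) geometry \<Rightarrow> 'q \<Rightarrow> 'q \<Rightarrow> 'q \<Rightarrow> 'm \<Rightarrow> 'm \<Rightarrow> 'm \<Rightarrow> bool" where
  "triangle D a b c p q r \<longleftrightarrow>
     points D = {a, b, c} \<and> a \<noteq> b \<and> b \<noteq> c \<and> a \<noteq> c \<and>
     lines D = {p, q, r} \<and> p \<noteq> q \<and> q \<noteq> r \<and> p \<noteq> r \<and>
     incidence D = {(a, q), (a, r), (b, p), (b, r), (c, p), (c, q)}"

lemma triangle_rotate: "triangle D a b c p q r \<Longrightarrow> triangle D b c a q r p"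
  by (auto simp: triangle_def)

lemma triangle_swap: "triangle D a b c p q r \<Longrightarrow> triangle D b a c q p r"
  by (auto simp: triangle_def)

lemma triangle_dual: "triangle D a b c p q r \<Longrightarrow> triangle (dual D) p q r a b c"
  by (auto simp: triangle_def dual_def)

lemma triangle_join:
  assumes "triangle D a b c p q r"
  shows "join D a b = r" "join D b c = p" "join D a c = q"
  using assms unfolding join_def triangle_def by (auto intro!: the_equality)

text \<open>Three non-collinear points have three distinct joins. These already use up both lines
  through each vertex and both points on each side, which leaves no room for a fourth point; every
  line then joins two of the three vertices.\<close>

lemma thin_projective_plane_triangle:
  assumes "thin_projective_plane D"
  obtains a b c p q r where "triangle D a b c p q r"
proof -
  have pp: "projective_plane D" using assms by (simp add: thin_projective_plane_def)
  note inc = projective_plane_incidence[OF pp]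
  note un = projective_plane_unique[OF pp]
  have two: "x = y \<or> y = z \<or> x = z"
    if "(x, l) \<in> incidence D" "(y, l) \<in> incidence D" "(z, l) \<in> incidence D" for x y z l
  proof -
    have "card (points_on D l) = 2" using assms inc that unfolding thin_projective_plane_def by blast
    then obtain u v where "points_on D l = {u, v}" by (auto simp: card_2_iff)
    moreover have "{x, y, z} \<subseteq> points_on D l" using inc that by (auto simp: points_on_def)
    ultimately show ?thesis by auto
  qed
  have two': "x = y \<or> y = z \<or> x = z"
    if "(l, x) \<in> incidence D" "(l, y) \<in> incidence D" "(l, z) \<in> incidence D" for x y z l
  proof -
    have "card (lines_through D l) = 2"
      using assms inc that unfolding thin_projective_plane_def by blast
    then obtain u v where "lines_through D l = {u, v}" by (auto simp: card_2_iff)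
    moreover have "{x, y, z} \<subseteq> lines_through D l" using inc that by (auto simp: lines_through_def)
    ultimately show ?thesis by auto
  qed
  have ex2: "\<exists>u v. u \<noteq> v \<and> (u, l) \<in> incidence D \<and> (v, l) \<in> incidence D" if "l \<in> lines D" for l
  proof -
    have "card (points_on D l) = 2" using assms that unfolding thin_projective_plane_def by blast
    then obtain u v where "points_on D l = {u, v}" "u \<noteq> v" by (auto simp: card_2_iff)
    then show ?thesis by (auto simp: points_on_def)
  qed
  have ex_line: "\<exists>l\<in>lines D. (x, l) \<in> incidence D" if "x \<in> points D" for x
  proof -
    have "card (lines_through D x) = 2" using assms that unfolding thin_projective_plane_def by blast
    then have "lines_through D x \<noteq> {}" by auto
    then show ?thesis by (auto simp: lines_through_def)
  qed
  \<comment> \<open>Coinciding points are allowed, so the three sides can be chosen before the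
    vertices are known to be distinct.\<close>
  have ex_join: "\<exists>l\<in>lines D. (x, l) \<in> incidence D \<and> (y, l) \<in> incidence D"
    if "x \<in> points D" "y \<in> points D" for x y
    using that ex_line[of x] projective_plane_line[OF pp, of x y] by (cases "x = y") auto
  obtain a b c where abc: "a \<in> points D" "b \<in> points D" "c \<in> points D"
    "\<not> (\<exists>l\<in>lines D. {a, b, c} \<subseteq> points_on D l)"
    using pp[unfolded projective_plane_def, THEN conjunct2, THEN conjunct2, THEN conjunct2]
    by (elim bexE) (rule that)
  then have nc: "\<not> ((a, l) \<in> incidence D \<and> (b, l) \<in> incidence D \<and> (c, l) \<in> incidence D)" for l
    using inc[of a l] by (auto simp: points_on_def)
  obtain p q r where pqr: "(b, p) \<in> incidence D" "(c, p) \<in> incidence D"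
      "(a, q) \<in> incidence D" "(c, q) \<in> incidence D" "(a, r) \<in> incidence D" "(b, r) \<in> incidence D"
    using ex_join[OF abc(2,3)] ex_join[OF abc(1,3)] ex_join[OF abc(1,2)] by blast
  have ne: "a \<noteq> b" "b \<noteq> c" "a \<noteq> c" "p \<noteq> q" "q \<noteq> r" "p \<noteq> r"
    using nc[of p] nc[of q] nc[of r] pqr by auto
  have pts: "points D = {a, b, c}"
  proof (intro equalityI subsetI)
    fix d assume d: "d \<in> points D"
    obtain l where l: "(a, l) \<in> incidence D" "(d, l) \<in> incidence D" using ex_join abc d by blast
    then have "l = q \<or> l = r" using two'[OF l(1) pqr(3,5)] ne by blast
    then show "d \<in> {a, b, c}"
      using two[of a q c d] two[of a r b d] l pqr ne by blast
  qed (use abc in auto)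
  have lns: "lines D = {p, q, r}"
  proof (intro equalityI subsetI)
    fix l assume "l \<in> lines D"
    then obtain u v where uv: "u \<noteq> v" "(u, l) \<in> incidence D" "(v, l) \<in> incidence D"
      using ex2 by blast
    then have "u \<in> {a, b, c}" "v \<in> {a, b, c}"
      using inc[OF uv(2)] inc[OF uv(3)] unfolding pts by simp_all
    moreover have "l = p" if "(b, l) \<in> incidence D" "(c, l) \<in> incidence D"
      using un[OF that pqr(1,2)] ne by blast
    moreover have "l = q" if "(a, l) \<in> incidence D" "(c, l) \<in> incidence D"
      using un[OF that pqr(3,4)] ne by blast
    moreover have "l = r" if "(a, l) \<in> incidence D" "(b, l) \<in> incidence D"
      using un[OF that pqr(5,6)] ne by blast
    ultimately show "l \<in> {p, q, r}" using uv by auto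
  qed (use inc[OF pqr(1)] inc[OF pqr(3)] inc[OF pqr(5)] in auto)
  have "incidence D = {(a, q), (a, r), (b, p), (b, r), (c, p), (c, q)}"
  proof (intro equalityI subsetI)
    fix z assume z: "z \<in> incidence D"
    obtain x l where xl: "z = (x, l)" by (cases z)
    have "(a, p) \<notin> incidence D" "(b, q) \<notin> incidence D" "(c, r) \<notin> incidence D"
      using nc[of p] nc[of q] nc[of r] pqr by simp_all
    moreover have "x \<in> {a, b, c}" "l \<in> {p, q, r}" using inc[of x l] z
      unfolding xl pts lns by simp_all
    ultimately show "z \<in> {(a, q), (a, r), (b, p), (b, r), (c, p), (c, q)}"
      using z xl by auto
  qed (use pqr in auto)
  then have "triangle D a b c p q r" using pts lns ne by (simp add: triangle_def)
  then show thesis by (rule that)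
qed

section \<open>Epimorphisms onto a triangle\<close>

text \<open>Surjectivity is recorded only at \<open>a\<close> and \<open>p\<close>; the other
  vertices and sides are reached by rotating the triangle.\<close>

lemma epimorphismD:
  assumes "epimorphism P D f g" "triangle D a b c p q r"
  shows "x \<in> points P \<Longrightarrow> f x = a \<or> f x = b \<or> f x = c"
    and "l \<in> lines P \<Longrightarrow> g l = p \<or> g l = q \<or> g l = r"
    and "\<exists>x\<in>points P. f x = a" and "\<exists>l\<in>lines P. g l = p"
proof -
  have im: "f ` points P = {a, b, c}" "g ` lines P = {p, q, r}"
    using assms by (auto simp: epimorphism_def triangle_def)
  show "x \<in> points P \<Longrightarrow> f x = a \<or> f x = b \<or> f x = c"
    using imageI[of x "points P" f] unfolding im by simp
  show "l \<in> lines P \<Longrightarrow> g l = p \<or> g l = q \<or> g l = r"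
    using imageI[of l "lines P" g] unfolding im by simp
  have "a \<in> f ` points P" "p \<in> g ` lines P" unfolding im by simp_all
  then show "\<exists>x\<in>points P. f x = a" "\<exists>l\<in>lines P. g l = p" by auto
qed

text \<open>In the triangle the only non-incident pairs are a vertex and its opposite side, so
  preservation of incidence amounts to these three exclusions.\<close>

lemma epimorphism_opposite:
  assumes "epimorphism P D f g" "triangle D a b c p q r" "projective_plane P"
    "(x, l) \<in> incidence P"
  shows "\<not> (f x = a \<and> g l = p)" "\<not> (f x = b \<and> g l = q)" "\<not> (f x = c \<and> g l = r)"
proof -
  have "(f x, g l) \<in> incidence D"
    using assms projective_plane_incidence[OF assms(3,4)]
    unfolding epimorphism_def morphism_def by blast
  then show "\<not> (f x = a \<and> g l = p)" "\<not> (f x = b \<and> g l = q)" "\<not> (f x = c \<and> g l = r)"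
    using assms(2) unfolding triangle_def by auto
qed

text \<open>If each point over \<open>a\<close> or \<open>b\<close> is on just one line over
  \<open>r\<close>, then the fibre of \<open>r\<close> is a single line \<open>L\<close>, and the
  points over \<open>a\<close> or \<open>b\<close> are exactly the points of \<open>L\<close>. Any
  other line is then typed by its intersection with \<open>L\<close>.\<close>

lemma class_aI:
  assumes "projective_plane P" "epimorphism P D f g" "triangle D a b c p q r"
    and one: "\<And>x. x \<in> points P \<Longrightarrow> f x = a \<or> f x = b \<Longrightarrow>
      card {l \<in> lines_through P x. g l = r} = 1"
  shows "class_a P D f g"
proof -
  note T = assms(3)
  note E = epimorphismD[OF assms(2)]
  note opp = epimorphism_opposite[OF assms(2,3,1)]
  have cl: "a \<noteq> b" "b \<noteq> c" "a \<noteq> c" "p \<noteq> q" "q \<noteq> r" "p \<noteq> r" "points D = {a, b, c}"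
    using T by (auto simp: triangle_def)
  have one': "\<exists>l\<in>lines P. (x, l) \<in> incidence P \<and> g l = r"
    "(x, l) \<in> incidence P \<Longrightarrow> (x, m) \<in> incidence P \<Longrightarrow> g l = r \<Longrightarrow> g m = r \<Longrightarrow> l = m"
    if x: "x \<in> points P" "f x = a \<or> f x = b" for x l m
  proof -
    obtain k where k: "{l \<in> lines_through P x. g l = r} = {k}"
      using one[OF x] by (auto simp: card_1_singleton_iff)
    then have "k \<in> {l \<in> lines_through P x. g l = r}" by simp
    then show "\<exists>l\<in>lines P. (x, l) \<in> incidence P \<and> g l = r" by (auto simp: lines_through_def)
    assume "(x, l) \<in> incidence P" "(x, m) \<in> incidence P" "g l = r" "g m = r"
    then have "l \<in> {l \<in> lines_through P x. g l = r}" "m \<in> {l \<in> lines_through P x. g l = r}"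
      using projective_plane_incidence[OF assms(1)] by (auto simp: lines_through_def)
    then show "l = m" unfolding k by simp
  qed
  obtain L where L: "L \<in> lines P" "g L = r"
    using E(4)[OF triangle_rotate[OF triangle_rotate[OF T]]] by blast
  have pt: "f x = a \<or> f x = b" if "(x, l) \<in> incidence P" "g l = r" for x l
    using E(1)[OF T, of x] opp(3)[OF that(1)] that projective_plane_incidence[OF assms(1) that(1)]
    by blast
  \<comment> \<open>Two lines over \<open>r\<close> would meet in a point that cannot lie over
    \<open>c\<close>, and this point would be on two lines over \<open>r\<close>.\<close>
  have "l = L" if l: "l \<in> lines P" "g l = r" for l
  proof (rule ccontr)
    assume "l \<noteq> L"
    then obtain x where x: "x \<in> points P" "(x, l) \<in> incidence P" "(x, L) \<in> incidence P"
      using projective_plane_meet[OF assms(1) l(1) L(1)] by blast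
    then show False using one'(2)[OF x(1) pt[OF x(2) l(2)] x(2,3)] l L \<open>l \<noteq> L\<close> by blast
  qed
  then have fib: "g l = r \<longleftrightarrow> l = L" if "l \<in> lines P" for l
    using that L(2) by blast
  have on: "(x, L) \<in> incidence P \<longleftrightarrow> f x = a \<or> f x = b" if x: "x \<in> points P" for x
  proof
    assume "(x, L) \<in> incidence P"
    then show "f x = a \<or> f x = b" using pt L(2) by simp
  next
    assume "f x = a \<or> f x = b"
    then obtain l where "l \<in> lines P" "(x, l) \<in> incidence P" "g l = r"
      using one'(1)[OF x] by blast
    then show "(x, L) \<in> incidence P" using fib by simp
  qed
  have lne: "\<exists>x\<in>points P. (x, l) \<in> incidence P \<and> (x, L) \<in> incidence P" if "l \<in> lines P" for l
  proof (cases "l = L")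
    case True
    obtain x where "x \<in> points P" "f x = a" using E(3)[OF T] by blast
    then show ?thesis using on True by blast
  qed (use projective_plane_meet[OF assms(1) that L(1)] in blast)
  \<comment> \<open>A line over \<open>p\<close> meets \<open>L\<close> in a point over
    \<open>a\<close> or \<open>b\<close>, and \<open>a\<close> is opposite to \<open>p\<close>.
    Conversely, a point over \<open>b\<close> rules out \<open>q\<close>, and being different from
    \<open>L\<close> rules out \<open>r\<close>.\<close>
  have lb: "g l = p \<longleftrightarrow> l \<noteq> L \<and> (\<exists>x\<in>points P. f x = b \<and> (x, l) \<in> incidence P)"
    if "l \<in> lines P" for l
  proof
    assume "g l = p"
    then show "l \<noteq> L \<and> (\<exists>x\<in>points P. f x = b \<and> (x, l) \<in> incidence P)"
      using lne[OF that] on opp(1) L(2) cl by blast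
  next
    assume "l \<noteq> L \<and> (\<exists>x\<in>points P. f x = b \<and> (x, l) \<in> incidence P)"
    then show "g l = p" using opp(2) fib[OF that] E(2)[OF T that] by blast
  qed
  have la: "g l = q \<longleftrightarrow> l \<noteq> L \<and> (\<exists>x\<in>points P. f x = a \<and> (x, l) \<in> incidence P)"
    if "l \<in> lines P" for l
  proof
    assume "g l = q"
    then show "l \<noteq> L \<and> (\<exists>x\<in>points P. f x = a \<and> (x, l) \<in> incidence P)"
      using lne[OF that] on opp(2) L(2) cl by blast
  next
    assume "l \<noteq> L \<and> (\<exists>x\<in>points P. f x = a \<and> (x, l) \<in> incidence P)"
    then show "g l = q" using opp(1) fib[OF that] E(2)[OF T that] by blast
  qed
  have pa: "\<exists>x\<in>points P. f x = a" using E(3)[OF T] .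
  have pb: "\<exists>x\<in>points P. f x = b" using E(3)[OF triangle_rotate[OF T]] .
  show ?thesis
    unfolding class_a_def Let_def
  proof (rule exI[of _ a], rule exI[of _ b], rule exI[of _ c], intro conjI bexI[of _ L])
    show "point_fibre P f a \<union> point_fibre P f b = points_on P L"
      using on by (auto simp: point_fibre_def points_on_def)
    show "point_fibre P f c = points P - points_on P L"
      using on E(1)[OF T] cl by (auto simp: point_fibre_def points_on_def)
    show "line_fibre P g (join D a b) = {L}"
      using L fib by (auto simp: line_fibre_def triangle_join(1)[OF T])
    show "line_fibre P g (join D b c) =
        {M \<in> lines P. M \<noteq> L \<and> (\<exists>x\<in>point_fibre P f b. (x, M) \<in> incidence P)}"
      using lb by (auto simp: line_fibre_def point_fibre_def triangle_join(2)[OF T])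
    show "line_fibre P g (join D a c) =
        {M \<in> lines P. M \<noteq> L \<and> (\<exists>x\<in>point_fibre P f a. (x, M) \<in> incidence P)}"
      using la by (auto simp: line_fibre_def point_fibre_def triangle_join(3)[OF T])
  qed (use cl pa pb L in \<open>auto simp: point_fibre_def\<close>)
qed

text \<open>This is \<open>class_aI\<close> in the dual plane, where the vertex \<open>c\<close>
  takes over the part of the side \<open>r\<close>.\<close>

lemma class_bI:
  assumes "thick_projective_plane P" "epimorphism P D f g" "triangle D a b c p q r"
    and one: "\<And>l. l \<in> lines P \<Longrightarrow> g l = p \<or> g l = q \<Longrightarrow>
      card {x \<in> points_on P l. f x = c} = 1"
  shows "class_b P D f g"
  unfolding class_b_def
  by (rule class_aI[OF thick_projective_plane_imp[OF thick_projective_plane_dual[OF assms(1)]]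
        iffD2[OF epimorphism_dual assms(2)] triangle_dual[OF assms(3)]])
     (use one in simp)

section \<open>Existence of epimorphisms of the first class\<close>

text \<open>Take an incident pair \<open>u\<close>, \<open>L\<close> and split the points of
  \<open>L\<close> into \<open>u\<close> alone, sent to \<open>a\<close>, and all the others, sent
  to \<open>b\<close>; the shape of class (a) then dictates the rest of both maps.\<close>

lemma ex_class_a:
  assumes "thick_projective_plane P" "triangle D a b c p q r"
  shows "\<exists>f g. epimorphism P D f g \<and> class_a P D f g"
proof -
  have pp: "projective_plane P" using assms(1) by (rule thick_projective_plane_imp)
  note un = projective_plane_unique[OF pp]
  obtain u where u: "u \<in> points P" using projective_plane_ex_point[OF pp] by blast
  obtain L where L: "L \<in> lines P" "(u, L) \<in> incidence P"
    using thick_third_line[OF assms(1) u] by blast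
  \<comment> \<open>The elements \<open>v\<close>, \<open>w\<close>, \<open>M\<close>,
    \<open>K\<close> are witnesses for surjectivity: they are sent to \<open>b\<close>,
    \<open>c\<close>, \<open>q\<close>, \<open>p\<close> respectively.\<close>
  obtain v where v: "v \<in> points P" "(v, L) \<in> incidence P" "v \<noteq> u"
    using thick_third_point[OF assms(1) L(1)] by blast
  obtain w where w: "w \<in> points P" "(w, L) \<notin> incidence P"
    using thick_point_avoiding[OF assms(1) L(1) L(1)] by blast
  obtain M where M: "M \<in> lines P" "(u, M) \<in> incidence P" "M \<noteq> L"
    using thick_third_line[OF assms(1) u] by blast
  obtain K where K: "K \<in> lines P" "(v, K) \<in> incidence P" "K \<noteq> L"
    using thick_third_line[OF assms(1) v(1)] by blast
  have "(u, K) \<notin> incidence P" using un L v K by blast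
  define f where "f x = (if x = u then a else if (x, L) \<in> incidence P then b else c)" for x
  define g where "g l = (if l = L then r else if (u, l) \<in> incidence P then q else p)" for l
  have dist: "a \<noteq> b" "b \<noteq> c" "a \<noteq> c" "p \<noteq> q" "q \<noteq> r" "p \<noteq> r"
    using assms(2) by (auto simp: triangle_def)
  have "{f u, f v, f w} \<subseteq> f ` points P" "{g L, g M, g K} \<subseteq> g ` lines P"
    using u v w L M K by auto
  moreover have "f u = a" "f v = b" "f w = c" "g L = r" "g M = q" "g K = p"
    using u v w L M K \<open>(u, K) \<notin> incidence P\<close> by (auto simp: f_def g_def)
  ultimately have "f ` points P = {a, b, c}" "g ` lines P = {p, q, r}"
    by (auto simp: f_def g_def)
  moreover have "(f x, g l) \<in> incidence D" if "(x, l) \<in> incidence P" for x l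
  proof -
    \<comment> \<open>The critical case of incidence: a line over \<open>q\<close> passes through
      \<open>u\<close> and differs from \<open>L\<close>, so it contains no point over
      \<open>b\<close>.\<close>
    have "(u, l) \<in> incidence P \<longrightarrow> (x, L) \<in> incidence P \<longrightarrow> x = u \<or> l = L"
      using un[of x l u L] that L(2) by simp
    then show ?thesis
      using that assms(2) L(2) by (auto simp: triangle_def f_def g_def)
  qed
  ultimately have epi: "epimorphism P D f g"
    using assms(2) unfolding epimorphism_def morphism_def triangle_def by auto
  have "card {l \<in> lines_through P x. g l = r} = 1" if "x \<in> points P" "f x = a \<or> f x = b" for x
  proof -
    have "(x, L) \<in> incidence P" using that dist L by (auto simp: f_def split: if_splits)
    then have "{l \<in> lines_through P x. g l = r} = {L}"
      using L dist by (auto simp: g_def lines_through_def split: if_splits)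
    then show ?thesis by simp
  qed
  then show ?thesis using class_aI[OF pp epi assms(2)] epi by blast
qed

section \<open>Counting\<close>

text \<open>As \<open>x\<close> lies over \<open>c\<close>, it is off \<open>L\<close>. The joins of
  \<open>x\<close> with points of \<open>L\<close> are over \<open>p\<close> or \<open>q\<close> and
  those points are over \<open>a\<close> or \<open>b\<close>; excluding opposite pairs matches
  \<open>a\<close> with \<open>q\<close> and \<open>b\<close> with \<open>p\<close>.\<close>

lemma card_perspective:
  assumes "projective_plane P" "epimorphism P D f g" "triangle D a b c p q r"
    "x \<in> points P" "f x = c" "L \<in> lines P" "g L = r"
  shows "card {y \<in> points_on P L. f y = a} = card {l \<in> lines_through P x. g l = q}"
proof -
  note opp = epimorphism_opposite[OF assms(2,3,1)]
  note E = epimorphismD[OF assms(2,3)]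
  have off: "(x, L) \<notin> incidence P" using opp(3) assms by blast
  note bij = bij_betw_perspective[OF assms(1,4,6) off]
  have type_iff: "g (join P x y) = q \<longleftrightarrow> f y = a" if y: "y \<in> points_on P L" for y
  proof -
    have j: "join P x y \<in> lines_through P x" using bij y by (auto simp: bij_betw_def)
    have "x \<noteq> y" using y off by (auto simp: points_on_def)
    then have yj: "(y, join P x y) \<in> incidence P"
      using projective_plane_line[OF assms(1,4), of y] join_eqI[OF assms(1), of x _ y] y
      by (auto simp: points_on_def)
    have "f y = a \<or> f y = b" "g (join P x y) = p \<or> g (join P x y) = q"
      using E(1)[of y] E(2)[of "join P x y"] opp(3) y j assms(5,7)
      by (auto simp: points_on_def lines_through_def)
    then show ?thesis using opp(1,2)[OF yj] by blast
  qed
  have "bij_betw (join P x) {y \<in> points_on P L. f y = a} {l \<in> lines_through P x. g l = q}"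
  proof (rule bij_betw_subset[OF bij])
    show "join P x ` {y \<in> points_on P L. f y = a} = {l \<in> lines_through P x. g l = q}"
      unfolding bij_betw_imp_surj_on[OF bij, symmetric] using type_iff by auto
  qed auto
  then show ?thesis by (rule bij_betw_same_card)
qed

text \<open>All counts at one corner, bundled with positivity so that the other two corners arise by
  rotating the arguments. Here \<open>i\<close> is the number called \<open>k\<close> in the
  overview, and \<open>j\<close> is its complement \<open>N - k\<close>.\<close>

definition profile ::
  "('p, 'l) geometry \<Rightarrow> ('p \<Rightarrow> 'q) \<Rightarrow> ('l \<Rightarrow> 'm) \<Rightarrow> 'q \<Rightarrow> 'q \<Rightarrow> 'q \<Rightarrow> 'm \<Rightarrow> 'm \<Rightarrow> 'm \<Rightarrow>
    nat \<Rightarrow> nat \<Rightarrow> bool" where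
  "profile P f g a b c p q r i j \<longleftrightarrow> 1 \<le> i \<and> 1 \<le> j \<and>
     (\<forall>l\<in>lines P. g l = r \<longrightarrow> card {y \<in> points_on P l. f y = a} = i \<and>
        card {y \<in> points_on P l. f y = b} = j) \<and>
     (\<forall>x\<in>points P. f x = c \<longrightarrow> card {l \<in> lines_through P x. g l = q} = i \<and>
        card {l \<in> lines_through P x. g l = p} = j)"

text \<open>\<open>card_perspective\<close> compares every line over \<open>r\<close> with every
  point over \<open>c\<close>, so all these counts agree with those at one fixed line and one fixed
  point. The sum is \<open>N\<close> because a line over \<open>r\<close> has only points over
  \<open>a\<close> and \<open>b\<close>.\<close>

lemma ex_profile:
  assumes "projective_plane P" "finite_geometry P" "epimorphism P D f g"
    "triangle D a b c p q r" "\<And>l. l \<in> lines P \<Longrightarrow> card (points_on P l) = N"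
  shows "\<exists>i j. i + j = N \<and> profile P f g a b c p q r i j"
proof -
  note T = assms(4)
  note T' = triangle_swap[OF T]
  note E = epimorphismD[OF assms(3)]
  note opp = epimorphism_opposite[OF assms(3) T assms(1)]
  obtain x where x: "x \<in> points P" "f x = c"
    using E(3)[OF triangle_rotate[OF triangle_rotate[OF T]]] by blast
  obtain L where L: "L \<in> lines P" "g L = r"
    using E(4)[OF triangle_rotate[OF triangle_rotate[OF T]]] by blast
  define i where "i = card {y \<in> points_on P L. f y = a}"
  define j where "j = card {y \<in> points_on P L. f y = b}"
  \<comment> \<open>The join of \<open>x\<close> with a point over \<open>a\<close> must lie over
    \<open>q\<close>. The vertices and sides are generalised here so that the swapped triangle gives
    the bound for \<open>j\<close>.\<close>
  have pos: "1 \<le> card {l \<in> lines_through P x. g l = q}" if T: "triangle D a b c p q r" for a b p q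
  proof -
    obtain y where y: "y \<in> points P" "f y = a" using E(3)[OF T] by blast
    have "x \<noteq> y" using x y T by (auto simp: triangle_def)
    then obtain l where l: "l \<in> lines P" "(x, l) \<in> incidence P" "(y, l) \<in> incidence P"
      using projective_plane_line[OF assms(1) x(1) y(1)] by blast
    have "g l = q" using epimorphism_opposite[OF assms(3) T assms(1)] E(2)[OF T l(1)] l x y by blast
    then have "{l \<in> lines_through P x. g l = q} \<noteq> {}" using l by (auto simp: lines_through_def)
    then show ?thesis
      using finite_lines_through[OF assms(2)] by (simp add: Suc_le_eq card_gt_0_iff)
  qed
  have i: "i = card {l \<in> lines_through P z. g l = q}" if "z \<in> points P" "f z = c" for z
    unfolding i_def by (rule card_perspective[OF assms(1,3) T that L])
  have j: "j = card {l \<in> lines_through P z. g l = p}" if "z \<in> points P" "f z = c" for z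
    unfolding j_def by (rule card_perspective[OF assms(1,3) T' that L])
  have "points_on P L = {y \<in> points_on P L. f y = a} \<union> {y \<in> points_on P L. f y = b}"
    using E(1)[OF T] opp(3) L by (auto simp: points_on_def)
  moreover have "card ({y \<in> points_on P L. f y = a} \<union> {y \<in> points_on P L. f y = b}) = i + j"
    unfolding i_def j_def using finite_points_on[OF assms(2)] T
    by (subst card_Un_disjoint) (auto simp: triangle_def)
  ultimately have "i + j = N" using assms(5)[OF L(1)] by simp
  moreover have "profile P f g a b c p q r i j"
    unfolding profile_def
    using card_perspective[OF assms(1,3) T x] card_perspective[OF assms(1,3) T' x] i[symmetric]
      j[symmetric] i[OF x] j[OF x] pos[OF T] pos[OF T'] by simp
  ultimately show ?thesis by blast
qed

text \<open>Count from a point \<open>z\<close> over \<open>c\<close>: the lines over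
  \<open>p\<close> through \<open>z\<close> contain no point over \<open>a\<close>, while each of
  the \<open>i\<close> lines over \<open>q\<close> contains \<open>m\<close> of them by the profile
  at the corner \<open>b\<close>.\<close>

lemma card_fibre:
  assumes "projective_plane P" "finite_geometry P" "epimorphism P D f g"
    "triangle D a b c p q r"
    "profile P f g a b c p q r i j" "profile P f g c a b r p q k m"
  shows "card {x \<in> points P. f x = a} = i * m"
proof -
  note opp = epimorphism_opposite[OF assms(3,4,1)]
  note E = epimorphismD[OF assms(3)]
  let ?A = "{x \<in> points P. f x = a}"
  obtain z where z: "z \<in> points P" "f z = c"
    using E(3)[OF triangle_rotate[OF triangle_rotate[OF assms(4)]]] by blast
  have "card ?A = (\<Sum>l\<in>lines_through P z. card (points_on P l \<inter> ?A))"
    by (rule card_eq_sum_lines_through[OF assms(1,2) z(1)])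
      (use z assms(4) in \<open>auto simp: triangle_def\<close>)
  also have "\<dots> = (\<Sum>l\<in>{l \<in> lines_through P z. g l = q}. card (points_on P l \<inter> ?A))"
  proof (rule sum.mono_neutral_right)
    show "\<forall>l\<in>lines_through P z - {l \<in> lines_through P z. g l = q}.
        card (points_on P l \<inter> ?A) = 0"
    proof
      fix l assume "l \<in> lines_through P z - {l \<in> lines_through P z. g l = q}"
      then have "g l = p"
        using E(2)[OF assms(4)] opp(3) z by (auto simp: lines_through_def)
      then have "points_on P l \<inter> ?A = {}" using opp(1) by (auto simp: points_on_def)
      then show "card (points_on P l \<inter> ?A) = 0" by simp
    qed
  qed (use finite_lines_through[OF assms(2)] in auto)
  also have "\<dots> = (\<Sum>l\<in>{l \<in> lines_through P z. g l = q}. m)"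
  proof (rule sum.cong[OF refl])
    fix l assume "l \<in> {l \<in> lines_through P z. g l = q}"
    moreover have "points_on P l \<inter> ?A = {y \<in> points_on P l. f y = a}"
      by (auto simp: points_on_def)
    ultimately show "card (points_on P l \<inter> ?A) = m"
      using assms(6) by (auto simp: profile_def lines_through_def)
  qed
  also have "\<dots> = i * m" using assms(5) z by (simp add: profile_def)
  finally show ?thesis .
qed

lemma profile_arith:
  fixes i j i' j' i'' j'' N :: nat
  assumes "i + j = N" "i' + j' = N" "i'' + j'' = N" "3 \<le> N"
    "1 \<le> i" "1 \<le> j" "1 \<le> i'" "1 \<le> j'" "1 \<le> i''" "1 \<le> j''"
    "i * j'' + i' * j + i'' * j' = N * (N - 1) + 1"
  shows "(i = 1 \<and> j' = 1) \<or> (i = 1 \<and> j'' = 1) \<or> (i' = 1 \<and> j = 1) \<or>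
    (i' = 1 \<and> j'' = 1) \<or> (i'' = 1 \<and> j = 1) \<or> (i'' = 1 \<and> j' = 1)"
proof -
  define M where "M = int N"
  define x y z where "x = int i" and "y = int i'" and "z = int i''"
  have js: "int j = M - x" "int j' = M - y" "int j'' = M - z"
    using assms by (auto simp: M_def x_def y_def z_def)
  have "int (i * j'' + i' * j + i'' * j') = int (N * (N - 1) + 1)" using assms by simp
  then have "x * (M - z) + y * (M - x) + z * (M - y) = M * (M - 1) + 1"
    using assms(4) by (simp add: js x_def[symmetric] y_def[symmetric] z_def[symmetric]
        M_def[symmetric] of_nat_diff)
  \<comment> \<open>Up to sign, this product expands to the sum of the two triple products in the
    next line; \<open>M - 2\<close> is the order minus one.\<close>
  then have "(M - 2) * (x * (M - z) + y * (M - x) + z * (M - y) - M * (M - 1) - 1) = 0" by simp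
  then have eq: "(M - x - 1) * (M - y - 1) * (M - z - 1) + (x - 1) * (y - 1) * (z - 1) = 0"
    by (simp add: algebra_simps)
  have nn: "0 \<le> M - x - 1" "0 \<le> M - y - 1" "0 \<le> M - z - 1"
    "0 \<le> x - 1" "0 \<le> y - 1" "0 \<le> z - 1"
    using assms js by (auto simp: x_def y_def z_def)
  \<comment> \<open>Both triple products are non-negative and add up to zero, so each of them has a
    vanishing factor.\<close>
  have "0 \<le> (M - x - 1) * (M - y - 1) * (M - z - 1)" "0 \<le> (x - 1) * (y - 1) * (z - 1)"
    using nn by simp_all
  then have "(M - x - 1) * (M - y - 1) * (M - z - 1) = 0" "(x - 1) * (y - 1) * (z - 1) = 0"
    using eq by linarith+
  then have "int j = 1 \<or> int j' = 1 \<or> int j'' = 1" "i = 1 \<or> i' = 1 \<or> i'' = 1"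
    unfolding js by (auto simp: x_def y_def z_def)
  \<comment> \<open>The two ones cannot come from the same corner, since \<open>i + j = N\<close>
    with \<open>3 \<le> N\<close> excludes \<open>i = j = 1\<close>. Six of the nine combinations
    remain.\<close>
  then show ?thesis using assms(1-4) by auto
qed

section \<open>The classification\<close>

lemma epimorphism_class:
  assumes "thick_projective_plane P" "finite_geometry P"
    "epimorphism P D f g" "triangle D a b c p q r"
  shows "class_a P D f g \<or> class_b P D f g"
proof -
  have pp: "projective_plane P" using assms(1) by (rule thick_projective_plane_imp)
  note T = assms(4)
  note T' = triangle_rotate[OF T]
  note T'' = triangle_rotate[OF T']
  note E = epimorphismD[OF assms(3) T]
  obtain N where N: "3 \<le> N" "\<And>l. l \<in> lines P \<Longrightarrow> card (points_on P l) = N"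
    "\<And>x. x \<in> points P \<Longrightarrow> card (lines_through P x) = N"
    using thick_finite_order[OF assms(1,2)] by blast
  note prof = ex_profile[OF pp assms(2,3) _ N(2)]
  obtain i j where ij: "i + j = N" "profile P f g a b c p q r i j" using prof[OF T] by blast
  obtain i' j' where ij': "i' + j' = N" "profile P f g b c a q r p i' j'"
    using prof[OF T'] by blast
  obtain i'' j'' where ij'': "i'' + j'' = N" "profile P f g c a b r p q i'' j''"
    using prof[OF T''] by blast
  note cf = card_fibre[OF pp assms(2,3)]
  let ?F = "\<lambda>d. {x \<in> points P. f x = d}"
  have fib: "card (?F a) = i * j''" "card (?F b) = i' * j" "card (?F c) = i'' * j'"
    using cf[OF T ij(2) ij''(2)] cf[OF T' ij'(2) ij(2)] cf[OF T'' ij''(2) ij'(2)] .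
  have fin: "finite (?F d)" for d using assms(2) by (simp add: finite_geometry_def)
  have "points P = ?F a \<union> ?F b \<union> ?F c" using E(1) by blast
  then have "card (points P) = card (?F a \<union> ?F b \<union> ?F c)" by simp
  also have "\<dots> = card (?F a \<union> ?F b) + card (?F c)"
    using T fin by (intro card_Un_disjoint) (auto simp: triangle_def)
  also have "card (?F a \<union> ?F b) = card (?F a) + card (?F b)"
    using T fin by (intro card_Un_disjoint) (auto simp: triangle_def)
  finally have cP: "card (points P) = i * j'' + i' * j + i'' * j'" unfolding fib .
  obtain x where x: "x \<in> points P" using E(3) by blast
  \<comment> \<open>Equating the count by fibres with the count along a pencil gives the one
    equation that ties the three profiles together.\<close>
  have tot: "i * j'' + i' * j + i'' * j' = N * (N - 1) + 1"
    using card_points[OF pp assms(2) x N(2) N(3)[OF x]] cP by simp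
  note P = ij(2)[unfolded profile_def] ij'(2)[unfolded profile_def] ij''(2)[unfolded profile_def]
  note A = class_aI[OF pp assms(3)] and B = class_bI[OF assms(1,3)]
  \<comment> \<open>In the unrotated triangle, points over \<open>a\<close> and \<open>b\<close> are
    on \<open>i'\<close> and \<open>j''\<close> lines over \<open>r\<close>, so
    \<open>i' = j'' = 1\<close> gives (a). Lines over \<open>p\<close> and \<open>q\<close> have
    \<open>j'\<close> and \<open>i''\<close> points over \<open>c\<close>, so
    \<open>j' = i'' = 1\<close> gives (b). The other four cases are rotations of these two.\<close>
  consider "i = 1 \<and> j' = 1" | "i = 1 \<and> j'' = 1" | "i' = 1 \<and> j = 1" | "i' = 1 \<and> j'' = 1" |
    "i'' = 1 \<and> j = 1" | "i'' = 1 \<and> j' = 1"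
    using profile_arith[OF ij(1) ij'(1) ij''(1) N(1) _ _ _ _ _ _ tot] P by blast
  then show ?thesis
  proof cases
    case 1 then have "class_a P D f g" using A[OF T''] P by blast
    then show ?thesis ..
  next
    case 2 then have "class_b P D f g" using B[OF T'] P by blast
    then show ?thesis ..
  next
    case 3 then have "class_b P D f g" using B[OF T''] P by blast
    then show ?thesis ..
  next
    case 4 then have "class_a P D f g" using A[OF T] P by blast
    then show ?thesis ..
  next
    case 5 then have "class_a P D f g" using A[OF T'] P by blast
    then show ?thesis ..
  next
    case 6 then have "class_b P D f g" using B[OF T] P by blast
    then show ?thesis ..
  qed
qed

theorem theorem3p1:
  fixes P :: "('p, 'l) geometry" and D :: "('q, 'm) geometry"
  assumes "thick_projective_plane P" and "finite_geometry P"
    and "thin_projective_plane D"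
  shows "(\<forall>f g. epimorphism P D f g \<longrightarrow> class_a P D f g \<or> class_b P D f g) \<and>
         (\<exists>f g. epimorphism P D f g \<and> class_a P D f g) \<and>
         (\<exists>f g. epimorphism P D f g \<and> class_b P D f g)"
proof -
  obtain a b c p q r where T: "triangle D a b c p q r"
    using thin_projective_plane_triangle[OF assms(3)] .
  \<comment> \<open>The construction for (a) is applied to the dual plane and the dual triangle;
    being an epimorphism is a self-dual property.\<close>
  have "\<exists>f g. epimorphism P D f g \<and> class_b P D f g"
    using ex_class_a[OF thick_projective_plane_dual[OF assms(1)] triangle_dual[OF T]]
    unfolding class_b_def epimorphism_dual by blast
  then show ?thesis
    using epimorphism_class[OF assms(1,2) _ T] ex_class_a[OF assms(1) T] by blast
qed

end
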